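(* Let $(\mathcal M,X)$ be an irreducible concurrent system and let $f=(f_\alpha)_{\alpha\in X}$ be a probabilistic valuation, with Möbius transform $h=(h_\alpha)_{\alpha\in X}$. Then any state-and-clique $(\alpha,c)$ is stable if and only if $h_\alpha(c)>0$. In particular, the property $h_\alpha(c)>0$ for a given state-and-clique $(\alpha,c)$ is independent of the probabilistic valuation $f$.
   Context: Trace monoids. Let $\Sigma$ be a finite set and $I\subseteq\Sigma\times\Sigma$ irreflexive and symmetric. The trace monoid $\mathcal M=\mathcal M(\Sigma,I)$ is presented by $\langle\Sigma\mid ab=ba\text{ for }(a,b)\in I\rangle$. Its elements are traces, $\varepsilon$ is the unit, $|x|$ is the length of $x$, and $x\leqslant y$ means $y=xz$ for some $z\in\mathcal M$. $\mathcal M$ is irreducible if the graph $(\Sigma,(\Sigma\times\Sigma)\setminus I)$ is connected. A clique is a trace $a_1\cdots a_k$ of letters with $(a_i,a_j)\in I$ for $i\neq j$ (empty trace included); $\mathcal C$ is the set of cliques, identified with subsets of $\Sigma$. For cliques write $c\to d$ if for every letter $b\in d$ there is a letter $a\in c$ with $(a,b)\notin I$. Every trace $x$ has a unique normal form $x=c_1\cdots c_n$ with non-empty cliques $c_i\to c_{i+1}$; put $C_i(x)=c_i$ for $i\leqslant n$ and $C_i(x)=\varepsilon$ for $i>n$. Infinite traces. An infinite trace is a sequence $\omega=(c_i)_{i\geqslant1}$ of non-empty cliques with $c_i\to c_{i+1}$ for all $i$; $C_i(\omega)=c_i$. The set $\partial\mathcal M$ of infinite traces carries its Borel $\sigma$-algebra.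 For $x\in\mathcal M$, $x\leqslant\omega$ means $x\leqslant C_1(\omega)\cdots C_n(\omega)$ for some $n$, and ${\uparrow}x=\{\omega\in\partial\mathcal M:x\leqslant\omega\}$. Concurrent systems. A concurrent system is a pair $(\mathcal M,X)$, $X$ a finite set of states, with a right monoid action of $\mathcal M$ on $X\sqcup\{\bot\}$, where $\bot\cdot x=\bot$ for all $x$. Put $\mathcal M_\alpha=\{x:\alpha\cdot x\neq\bot\}$, $\mathcal M_{\alpha,\beta}=\{x:\alpha\cdot x=\beta\}$, and $\partial\mathcal M_\alpha=\{\omega\in\partial\mathcal M: x\in\mathcal M_\alpha\text{ for all }x\in\mathcal M\text{ with }x\leqslant\omega\}$. Non-trivial: $\alpha\cdot a\neq\bot$ for some $\alpha\in X$, $a\in\Sigma$. Transitive: $\mathcal M_{\alpha,\beta}\neq\emptyset$ for all $\alpha,\beta\in X$. Irreducible: (1) transitive and non-trivial; (2) $\mathcal M$ is irreducible; (3) for all $\alpha\in X$, $a\in\Sigma$ there is $u\in\mathcal M$ with $\alpha\cdot(ua)\neq\bot$. Probabilistic valuations. A valuation is a family $f=(f_\alpha)_{\alpha\in X}$ of functions $f_\alpha:\mathcal M\to\mathbb R_{\geqslant0}$ with $f_\alpha(x)>0\iff\alpha\cdot x\neq\bot$ and $f_\alpha(xy)=f_\alpha(x)f_{\alpha\cdot x}(y)$ (right-hand side $0$ if $\alpha\cdot x=\bot$). A Markov measure is a family $m=(m_\alpha)_{\alpha\in X}$ of probability measures on $\partial\mathcal M$ with $m_\alpha(\partial\mathcal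 M_\alpha)=1$, $x\in\mathcal M_\alpha\iff m_\alpha({\uparrow}x)>0$, and $m_\alpha({\uparrow}(xy))=m_\alpha({\uparrow}x)\,m_{\alpha\cdot x}({\uparrow}y)$. A valuation $f$ is probabilistic if $f_\alpha(x)=m_\alpha({\uparrow}x)$ for all $(\alpha,x)\in X\times\mathcal M$, for some Markov measure $m$. The Möbius transform of $f$ is $h_\alpha(c)=\sum_{c'\in\mathcal C,\,c\leqslant c'}(-1)^{|c'|-|c|}f_\alpha(c')$ for $\alpha\in X$, $c\in\mathcal C$. State-and-cliques. A state-and-clique is a pair $(\alpha,c)$ with $\alpha\in X$, $c$ a non-empty clique, $\alpha\cdot c\neq\bot$. It is stable if there is $x\in\mathcal M_\alpha$ such that every $z\in\mathcal M_\alpha$ with $x\leqslant z$ satisfies $C_1(z)=c$. *)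

theory Defs
  imports "HOL-Probability.Probability"
begin

section \<open>Trace monoids\<close>

text \<open>
  A finite alphabet \<open>\<Sigma>\<close> (the type) together with an irreflexive and symmetric independence
  relation \<open>I\<close> is an instance of the following class.
\<close>

class independence_alphabet = finite +
  fixes indep :: "'a \<Rightarrow> 'a \<Rightarrow> bool"
  assumes indep_irrefl: "\<not> indep a a"
    and indep_sym: "indep a b \<Longrightarrow> indep b a"

inductive swap_step :: "'a::independence_alphabet list \<Rightarrow> 'a list \<Rightarrow> bool" where
  swap: "indep a b \<Longrightarrow> swap_step (u @ a # b # v) (u @ b # a # v)"

text \<open>
  The reflexive, symmetric and transitive closure of \<^const>\<open>swap_step\<close> is the congruence on words
  generated by \<open>ab = ba\<close> for \<open>(a, b) \<in> I\<close>.
\<close>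

quotient_type (overloaded) 'a trace = "'a::independence_alphabet list" / "equivclp swap_step"
  by (rule equivp_evquivclp)

lemma equivclp_invariant:
  assumes "equivclp r x y" and "\<And>x y. r x y \<Longrightarrow> f x = f y"
  shows "f x = f y"
  using assms(1) by (induction rule: equivclp_induct) (auto dest: assms(2))

lemma equivclp_swap_step_context:
  assumes "equivclp swap_step x y"
  shows "equivclp swap_step (u @ x @ v) (u @ y @ v)"
  using assms
proof (induction rule: equivclp_induct)
  case base
  show ?case by simp
next
  case (step y z)
  have ctx: "swap_step (u @ s @ v) (u @ t @ v)" if "swap_step s t" for s t
    using that
  proof cases
    case (swap a b p q)
    then show ?thesis using swap_step.swap[of a b "u @ p" "q @ v"] by simp
  qed
  from step.hyps(2) have "equivclp swap_step (u @ y @ v) (u @ z @ v)"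
    by (auto intro: ctx r_into_equivclp converse_r_into_equivclp)
  with step.IH show ?case by (rule equivclp_trans)
qed

lemma swap_step_set: "swap_step x y \<Longrightarrow> set x = set y"
  by (induction rule: swap_step.induct) auto

lemma swap_step_length: "swap_step x y \<Longrightarrow> length x = length y"
  by (induction rule: swap_step.induct) auto

instantiation trace :: (independence_alphabet) monoid_mult
begin

lift_definition one_trace :: "'a trace" is "[]" .

lift_definition times_trace :: "'a trace \<Rightarrow> 'a trace \<Rightarrow> 'a trace" is "(@)"
proof -
  fix x x' y y' :: "'a list"
  assume "equivclp swap_step x x'" "equivclp swap_step y y'"
  then have "equivclp swap_step (x @ y) (x' @ y)" "equivclp swap_step (x' @ y) (x' @ y')"
    using equivclp_swap_step_context[of x x' "[]" y] equivclp_swap_step_context[of y y' x' "[]"]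
    by simp_all
  then show "equivclp swap_step (x @ y) (x' @ y')" by (rule equivclp_trans)
qed

instance
  by standard (transfer, simp)+

end

lift_definition letter :: "'a::independence_alphabet \<Rightarrow> 'a trace" is "\<lambda>a. [a]" .

lift_definition letters :: "'a::independence_alphabet trace \<Rightarrow> 'a set" is set
  by (erule equivclp_invariant) (rule swap_step_set)

lift_definition tlength :: "'a::independence_alphabet trace \<Rightarrow> nat" is length
  by (erule equivclp_invariant) (rule swap_step_length)

lemma tlength_times: "tlength (x * y) = tlength x + tlength y"
  by transfer simp

lemma tlength_eq_0_iff: "tlength x = 0 \<longleftrightarrow> x = 1"
proof
  show "tlength x = 0 \<Longrightarrow> x = 1" by transfer simp
  show "x = 1 \<Longrightarrow> tlength x = 0" by (simp, transfer, simp)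
qed

instantiation trace :: (independence_alphabet) order
begin

definition less_eq_trace :: "'a trace \<Rightarrow> 'a trace \<Rightarrow> bool" where
  "less_eq_trace x y \<longleftrightarrow> (\<exists>z. y = x * z)"

definition less_trace :: "'a trace \<Rightarrow> 'a trace \<Rightarrow> bool" where
  "less_trace x y \<longleftrightarrow> x \<le> y \<and> \<not> y \<le> (x :: 'a trace)"

instance
proof
  fix x y z :: "'a trace"
  show "x < y \<longleftrightarrow> x \<le> y \<and> \<not> y \<le> x" by (rule less_trace_def)
  show "x \<le> x" unfolding less_eq_trace_def by (metis mult_1_right)
  show "x \<le> y \<Longrightarrow> y \<le> z \<Longrightarrow> x \<le> z" unfolding less_eq_trace_def by (metis mult.assoc)
  assume "x \<le> y" "y \<le> x"
  then obtain u v where uv: "y = x * u" "x = y * v" unfolding less_eq_trace_def by auto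
  then have "tlength y = tlength x + tlength u" "tlength x = tlength y + tlength v"
    by (metis tlength_times)+
  then have "tlength u = 0" by simp
  with uv show "x = y" by (simp add: tlength_eq_0_iff)
qed

end

text \<open>
  Irreducibility: the graph \<open>(\<Sigma>, (\<Sigma> \<times> \<Sigma>) \<setminus> I)\<close> is connected.
\<close>

definition irreducible_trace_monoid :: "'a::independence_alphabet itself \<Rightarrow> bool" where
  "irreducible_trace_monoid _ \<longleftrightarrow> (\<forall>a b :: 'a. (\<lambda>a b. \<not> indep a b)\<^sup>*\<^sup>* a b)"

subsection \<open>Cliques and normal forms\<close>

definition cliques :: "'a::independence_alphabet trace set" where
  "cliques = {prod_list (map letter as) | as. sorted_wrt indep as}"

lemma finite_cliques: "finite (cliques :: 'a::independence_alphabet trace set)"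
proof -
  have "distinct as" if "sorted_wrt indep as" for as :: "'a list"
    using that by (induction as) (auto simp: indep_irrefl)
  then have "cliques \<subseteq> (\<lambda>as. prod_list (map letter as)) ` {as :: 'a list. set as \<subseteq> UNIV \<and> distinct as}"
    unfolding cliques_def by auto
  then show ?thesis
    by (rule finite_subset) (intro finite_imageI finite_subset_distinct finite)
qed

definition clique_arrow :: "'a::independence_alphabet trace \<Rightarrow> 'a trace \<Rightarrow> bool" where
  "clique_arrow c d \<longleftrightarrow> (\<forall>b\<in>letters d. \<exists>a\<in>letters c. \<not> indep a b)"

definition is_normal_form :: "'a::independence_alphabet trace \<Rightarrow> 'a trace list \<Rightarrow> bool" where
  "is_normal_form x cs \<longleftrightarrow>
     set cs \<subseteq> cliques - {1} \<and> successively clique_arrow cs \<and> x = prod_list cs"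

text \<open>
  Every trace has exactly one normal form (the Cartier-Foata normal form; \<open>[]\<close> for the unit).
\<close>

definition normal_form :: "'a::independence_alphabet trace \<Rightarrow> 'a trace list" where
  "normal_form x = (THE cs. is_normal_form x cs)"

definition nf_clique :: "nat \<Rightarrow> 'a::independence_alphabet trace \<Rightarrow> 'a trace" where
  \<comment> \<open>\<open>C\<^sub>i(x)\<close>, for \<open>i \<ge> 1\<close>\<close>
  "nf_clique i x = (if i \<le> length (normal_form x) then normal_form x ! (i - 1) else 1)"

subsection \<open>Infinite traces\<close>

text \<open>
  An infinite trace \<open>\<omega>\<close> is a function on \<^typ>\<open>nat\<close>, indexed from \<open>0\<close>: \<open>\<omega> i\<close> is \<open>C\<^bsub>i+1\<^esub>(\<omega>)\<close>.
\<close>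

definition infinite_traces :: "(nat \<Rightarrow> 'a::independence_alphabet trace) set" where
  "infinite_traces = {\<omega>. \<forall>i. \<omega> i \<in> cliques - {1} \<and> clique_arrow (\<omega> i) (\<omega> (Suc i))}"

definition prefix_inf :: "'a::independence_alphabet trace \<Rightarrow> (nat \<Rightarrow> 'a trace) \<Rightarrow> bool" where
  "prefix_inf x \<omega> \<longleftrightarrow> (\<exists>n. x \<le> prod_list (map \<omega> [0..<n]))"

definition up :: "'a::independence_alphabet trace \<Rightarrow> (nat \<Rightarrow> 'a trace) set" where
  "up x = {\<omega> \<in> infinite_traces. prefix_inf x \<omega>}"

text \<open>
  The topology on infinite traces is the one inherited from the product of the discrete finite
  sets of cliques.
\<close>

definition boundary_topology :: "(nat \<Rightarrow> 'a::independence_alphabet trace) topology" where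
  "boundary_topology =
     subtopology (product_topology (\<lambda>_. discrete_topology cliques) UNIV) infinite_traces"

definition boundary_borel :: "(nat \<Rightarrow> 'a::independence_alphabet trace) measure" where
  "boundary_borel = sigma infinite_traces {U. openin boundary_topology U}"

section \<open>Concurrent systems\<close>

text \<open>
  The finite set of states \<open>X\<close> is a type of class \<^class>\<open>finite\<close>; \<open>X \<squnion> {\<bottom>}\<close> is the option type,
  with \<^const>\<open>None\<close> for \<open>\<bottom>\<close>, and \<open>act s x\<close> stands for \<open>s \<cdot> x\<close>.
\<close>

type_synonym ('s, 'a) action = "'s option \<Rightarrow> 'a trace \<Rightarrow> 's option"

definition concurrent_system :: "('s::finite, 'a::independence_alphabet) action \<Rightarrow> bool" where
  "concurrent_system act \<longleftrightarrow>
     (\<forall>s. act s 1 = s) \<and>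
     (\<forall>s x y. act s (x * y) = act (act s x) y) \<and>
     (\<forall>x. act None x = None)"

definition traces_from :: "('s::finite, 'a::independence_alphabet) action \<Rightarrow> 's \<Rightarrow> 'a trace set" where
  "traces_from act \<alpha> = {x. act (Some \<alpha>) x \<noteq> None}"

definition traces_between ::
    "('s::finite, 'a::independence_alphabet) action \<Rightarrow> 's \<Rightarrow> 's \<Rightarrow> 'a trace set" where
  "traces_between act \<alpha> \<beta> = {x. act (Some \<alpha>) x = Some \<beta>}"

definition infinite_traces_from ::
    "('s::finite, 'a::independence_alphabet) action \<Rightarrow> 's \<Rightarrow> (nat \<Rightarrow> 'a trace) set" where
  "infinite_traces_from act \<alpha> =
     {\<omega> \<in> infinite_traces. \<forall>x. prefix_inf x \<omega> \<longrightarrow> x \<in> traces_from act \<alpha>}"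

definition nontrivial_system :: "('s::finite, 'a::independence_alphabet) action \<Rightarrow> bool" where
  "nontrivial_system act \<longleftrightarrow> (\<exists>\<alpha> a. act (Some \<alpha>) (letter a) \<noteq> None)"

definition transitive_system :: "('s::finite, 'a::independence_alphabet) action \<Rightarrow> bool" where
  "transitive_system act \<longleftrightarrow> (\<forall>\<alpha> \<beta>. traces_between act \<alpha> \<beta> \<noteq> {})"

definition irreducible_system :: "('s::finite, 'a::independence_alphabet) action \<Rightarrow> bool" where
  "irreducible_system act \<longleftrightarrow>
     concurrent_system act \<and>
     transitive_system act \<and> nontrivial_system act \<and>
     irreducible_trace_monoid TYPE('a) \<and>
     (\<forall>\<alpha> a. \<exists>u. act (Some \<alpha>) (u * letter a) \<noteq> None)"

section \<open>Probabilistic valuations\<close>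

definition valuation ::
    "('s::finite, 'a::independence_alphabet) action \<Rightarrow> ('s \<Rightarrow> 'a trace \<Rightarrow> real) \<Rightarrow> bool" where
  "valuation act f \<longleftrightarrow>
     (\<forall>\<alpha> x. 0 \<le> f \<alpha> x) \<and>
     (\<forall>\<alpha> x. f \<alpha> x > 0 \<longleftrightarrow> act (Some \<alpha>) x \<noteq> None) \<and>
     (\<forall>\<alpha> x y. f \<alpha> (x * y) =
        (case act (Some \<alpha>) x of None \<Rightarrow> 0 | Some \<beta> \<Rightarrow> f \<alpha> x * f \<beta> y))"

definition markov_measure ::
    "('s::finite, 'a::independence_alphabet) action \<Rightarrow> ('s \<Rightarrow> (nat \<Rightarrow> 'a trace) measure) \<Rightarrow> bool" where
  "markov_measure act m \<longleftrightarrow>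
     (\<forall>\<alpha>. prob_space (m \<alpha>) \<and> sets (m \<alpha>) = sets boundary_borel) \<and>
     (\<forall>\<alpha>. measure (m \<alpha>) (infinite_traces_from act \<alpha>) = 1) \<and>
     (\<forall>\<alpha> x. x \<in> traces_from act \<alpha> \<longleftrightarrow> measure (m \<alpha>) (up x) > 0) \<and>
     (\<forall>\<alpha> x y. measure (m \<alpha>) (up (x * y)) =
        (case act (Some \<alpha>) x of None \<Rightarrow> 0
         | Some \<beta> \<Rightarrow> measure (m \<alpha>) (up x) * measure (m \<beta>) (up y)))"

definition probabilistic_valuation ::
    "('s::finite, 'a::independence_alphabet) action \<Rightarrow> ('s \<Rightarrow> 'a trace \<Rightarrow> real) \<Rightarrow> bool" where
  "probabilistic_valuation act f \<longleftrightarrow>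
     valuation act f \<and> (\<exists>m. markov_measure act m \<and> (\<forall>\<alpha> x. f \<alpha> x = measure (m \<alpha>) (up x)))"

definition moebius_transform ::
    "('s \<Rightarrow> 'a::independence_alphabet trace \<Rightarrow> real) \<Rightarrow> 's \<Rightarrow> 'a trace \<Rightarrow> real" where
  "moebius_transform f \<alpha> c =
     (\<Sum>c' | c' \<in> cliques \<and> c \<le> c'. (- 1) ^ (tlength c' - tlength c) * f \<alpha> c')"

section \<open>State-and-cliques\<close>

definition state_and_clique ::
    "('s::finite, 'a::independence_alphabet) action \<Rightarrow> 's \<Rightarrow> 'a trace \<Rightarrow> bool" where
  "state_and_clique act \<alpha> c \<longleftrightarrow> c \<in> cliques \<and> c \<noteq> 1 \<and> act (Some \<alpha>) c \<noteq> None"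

definition stable_state_clique ::
    "('s::finite, 'a::independence_alphabet) action \<Rightarrow> 's \<Rightarrow> 'a trace \<Rightarrow> bool" where
  "stable_state_clique act \<alpha> c \<longleftrightarrow>
     (\<exists>x\<in>traces_from act \<alpha>. \<forall>z\<in>traces_from act \<alpha>. x \<le> z \<longrightarrow> nf_clique 1 z = c)"

end

theory Submission
  imports Defs "HOL-Library.Sublist"
begin

text \<open>
  The proof rests on two identities between the data of the theorem and the Markov measure \<open>m\<close>
  behind the valuation. First, a clique lies below an infinite trace \<open>\<omega>\<close> exactly when it lies
  below \<open>C\<^sub>1(\<omega>)\<close>, so Moebius inversion over the Boolean lattices of cliques turns the
  probabilities of the sets \<open>\<up>c\<close> into \<open>h\<^bsub>\<alpha>\<^esub>(c) = m\<^bsub>\<alpha>\<^esub>(C\<^sub>1 = c)\<close> (\<open>moebius_sum_up\<close>). Second,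
  if all letters occur in a trace \<open>x\<close>, then extending \<open>x\<close> cannot create new minimal letters, so
  all extensions of \<open>x\<close> have the same first clique (\<open>le_keeps_minimal_letters\<close>).

  If \<open>(\<alpha>, c)\<close> is stable with witness \<open>x\<close>, then almost all of \<open>\<up>x\<close>, a set of positive measure,
  lies in \<open>{C\<^sub>1 = c}\<close>, hence \<open>h\<^bsub>\<alpha>\<^esub>(c) > 0\<close>. Conversely, if \<open>{C\<^sub>1 = c}\<close> has positive measure, it
  contains an \<open>\<omega>\<close> executable from \<open>\<alpha>\<close> in which all letters occur, because the latter holds almost
  surely (\<open>AE_all_letters_occur\<close>); a finite prefix of \<open>\<omega>\<close> that contains all letters is then a
  witness of stability.

  That all letters occur almost surely is where irreducibility enters. Some letter occurs infinitely
  often in \<open>\<omega>\<close>. If a letter is missing, connectedness of the dependence graph yields dependent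
  letters \<open>a \<noteq> b\<close>, of which \<open>a\<close> occurs infinitely often and \<open>b\<close> only finitely often. So it
  suffices that, after any finite trace \<open>x\<close>, it has probability zero that \<open>a\<close> occurs infinitely
  often and \<open>b\<close> does not occur. For this one stops \<open>\<omega>\<close> at its smallest prefix \<open>x v\<close> in which
  \<open>a\<close> has occurred \<open>k\<close> times since \<open>x\<close>. These prefixes exist and are unique
  (\<open>common_prefix_min_occ\<close>), so the sets \<open>\<up>(x v)\<close> are disjoint, and on each of them the future is
  a fresh copy of the Markov measure. From each of the finitely many states some trace \<open>u b\<close> can be
  executed, with probability at least some \<open>p > 0\<close>. Since \<open>a\<close> and \<open>b\<close> are dependent, their
  occurrences in \<open>\<omega>\<close> are linearly ordered, so executing \<open>u b\<close> is incompatible with \<open>K\<close> further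
  occurrences of \<open>a\<close> before the first \<open>b\<close>, once \<open>K\<close> exceeds the number of \<open>a\<close> in \<open>u\<close>.
  Hence the probability of avoiding \<open>b\<close> shrinks by the factor \<open>1 - p\<close> with every \<open>K\<close>
  occurrences of \<open>a\<close> (\<open>avoiding_contraction\<close>).
\<close>

section \<open>Traces and their projections to dependent pairs\<close>

lemma trace_cases_word: obtains w where "x = prod_list (map letter w)"
proof -
  have "\<exists>w. x = prod_list (map letter w)"
  proof (induction x rule: trace.abs_induct)
    fix w :: "'a list"
    have "abs_trace w = prod_list (map letter w)"
      by (induction w) (simp_all add: one_trace_def letter.abs_eq times_trace.abs_eq [symmetric],
          metis append_Cons append_Nil letter.abs_eq times_trace.abs_eq)
    then show "\<exists>v. abs_trace w = prod_list (map letter v)" by blast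
  qed
  then show thesis using that by blast
qed

lemma trace_induct [case_names one letter]:
  assumes "P 1" and "\<And>a x. P x \<Longrightarrow> P (letter a * x)"
  shows "P x"
proof -
  obtain w where "x = prod_list (map letter w)" by (rule trace_cases_word)
  moreover have "P (prod_list (map letter w))" by (induction w) (auto intro: assms)
  ultimately show ?thesis by simp
qed

lemma countable_traces: "countable (UNIV :: 'a::independence_alphabet trace set)"
proof -
  have "(UNIV :: 'a trace set) = range (\<lambda>w. prod_list (map letter w))"
    by (metis surjI trace_cases_word surj_def)
  then show ?thesis by (metis countable_image countableI_type)
qed

lemma letter_commute: "indep a b \<Longrightarrow> letter a * letter b = letter b * letter a"
proof transfer
  fix a b :: 'a assume "indep a b"
  from swap[OF this, of "[]" "[]"] show "equivclp swap_step ([a] @ [b]) ([b] @ [a])"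
    by (simp add: r_into_equivclp)
qed

lemma letters_one [simp]: "letters 1 = {}" by transfer simp
lemma letters_times [simp]: "letters (x * y) = letters x \<union> letters y" by transfer simp
lemma letters_letter [simp]: "letters (letter a) = {a}" by transfer simp
lemma tlength_one [simp]: "tlength 1 = 0" by (simp add: tlength_eq_0_iff)
lemma tlength_letter [simp]: "tlength (letter a) = 1" by transfer simp

lemma letters_empty_iff: "letters x = {} \<longleftrightarrow> x = 1"
  by (induction x rule: trace_induct) (auto simp flip: tlength_eq_0_iff simp: tlength_times)

text \<open>
  The subword of the occurrences of \<open>a\<close> and \<open>b\<close> is invariant under the commutation relations only
  if \<open>a\<close> and \<open>b\<close> are dependent; the empty default for independent letters makes the function
  total. The case \<open>a = b\<close> is included, as every letter depends on itself.
\<close>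

lift_definition proj :: "'a::independence_alphabet \<Rightarrow> 'a \<Rightarrow> 'a trace \<Rightarrow> 'a list"
  is "\<lambda>a b w. if indep a b then [] else filter (\<lambda>c. c = a \<or> c = b) w"
proof -
  fix a b :: 'a and v w :: "'a list"
  assume "equivclp swap_step v w"
  then show "(if indep a b then [] else filter (\<lambda>c. c = a \<or> c = b) v)
           = (if indep a b then [] else filter (\<lambda>c. c = a \<or> c = b) w)"
    by (rule equivclp_invariant) (erule swap_step.cases, auto dest: indep_sym simp: indep_irrefl)
qed

lemma proj_one [simp]: "proj a b 1 = []" by transfer simp
lemma proj_times [simp]: "proj a b (x * y) = proj a b x @ proj a b y" by transfer simp
lemma proj_letter:
  "proj a b (letter c) = (if \<not> indep a b \<and> (c = a \<or> c = b) then [c] else [])"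
  by transfer simp
lemma set_proj: "\<not> indep a b \<Longrightarrow> set (proj a b x) = letters x \<inter> {a, b}"
  by transfer auto

lift_definition occ :: "'a::independence_alphabet \<Rightarrow> 'a trace \<Rightarrow> nat" is "\<lambda>a w. count_list w a"
  by (erule equivclp_invariant) (erule swap_step.cases, auto)

lemma occ_one [simp]: "occ a 1 = 0" by transfer simp
lemma occ_times [simp]: "occ a (x * y) = occ a x + occ a y" by transfer simp
lemma occ_letter [simp]: "occ a (letter b) = (if a = b then 1 else 0)" by transfer simp
lemma occ_eq_0_iff: "occ a x = 0 \<longleftrightarrow> a \<notin> letters x" by transfer (simp add: count_list_0_iff)
lemma count_proj: "\<not> indep a b \<Longrightarrow> count_list (proj a b x) a = occ a x"
  by transfer (auto simp: count_list_eq_length_filter intro!: arg_cong[of _ _ length] filter_cong)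

lemma le_times [simp]: "x \<le> x * (y :: 'a::independence_alphabet trace)"
  by (auto simp: less_eq_trace_def)

lemma one_le [simp]: "1 \<le> (x :: 'a::independence_alphabet trace)"
  by (auto simp: less_eq_trace_def)

lemma times_left_mono: "y \<le> z \<Longrightarrow> x * y \<le> x * (z :: 'a::independence_alphabet trace)"
  by (auto simp: less_eq_trace_def mult.assoc)

lemma proj_prefix: "x \<le> z \<Longrightarrow> prefix (proj a b x) (proj a b z)"
  by (auto simp: less_eq_trace_def)

text \<open>
  A letter can be moved to the front of a word as soon as its first occurrence is preceded by
  independent letters only. For a letter \<open>a\<close> this is what the condition on the projections says; its
  instance \<open>b = a\<close> ensures that \<open>a\<close> occurs at all.
\<close>

lemma letter_le_iff: "letter a \<le> z \<longleftrightarrow> (\<forall>b. \<not> indep a b \<longrightarrow> prefix [a] (proj a b z))"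
proof
  assume "letter a \<le> z"
  then show "\<forall>b. \<not> indep a b \<longrightarrow> prefix [a] (proj a b z)"
    using proj_prefix[of "letter a" z a] by (metis proj_letter)
next
  assume "\<forall>b. \<not> indep a b \<longrightarrow> prefix [a] (proj a b z)"
  then show "letter a \<le> z"
  proof (induction z rule: trace_induct)
    case one
    then show ?case using indep_irrefl[of a] by auto
  next
    case (letter e z)
    show ?case
    proof (cases "e = a")
      case False
      have ea: "indep e a"
      proof (rule ccontr)
        assume "\<not> indep e a"
        then have "\<not> indep a e" by (auto dest: indep_sym)
        with letter.prems False show False by (auto simp: proj_letter)
      qed
      have "prefix [a] (proj a b z)" if "\<not> indep a b" for b
        using letter.prems[rule_format, OF that] that False ea
        by (auto simp: proj_letter dest: indep_sym split: if_splits)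
      then have "letter a \<le> z" using letter.IH by blast
      then obtain y where "z = letter a * y" by (auto simp: less_eq_trace_def)
      then have "letter e * z = letter a * (letter e * y)"
        using letter_commute[OF ea] by (metis mult.assoc)
      then show ?thesis by simp
    qed simp
  qed
qed

text \<open>
  The projections embed the prefix order of traces into a product of prefix orders of words. For
  the reverse implication, the first letter of \<open>x\<close> begins all of its projections in \<open>z\<close>, so it
  can be split off from both sides. Cancellation and the criteria for minimal letters below are
  read off from this embedding.
\<close>

theorem le_iff_proj_prefix:
  "x \<le> z \<longleftrightarrow> (\<forall>a b. \<not> indep a b \<longrightarrow> prefix (proj a b x) (proj a b z))"
proof
  show "\<forall>a b. \<not> indep a b \<longrightarrow> prefix (proj a b x) (proj a b z)" if "x \<le> z"
    using that by (auto intro: proj_prefix)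
next
  assume "\<forall>a b. \<not> indep a b \<longrightarrow> prefix (proj a b x) (proj a b z)"
  then show "x \<le> z"
  proof (induction x arbitrary: z rule: trace_induct)
    case (letter a x)
    have "prefix [a] (proj a b z)" if "\<not> indep a b" for b
      using letter.prems[rule_format, OF that] that by (auto simp: proj_letter prefix_def)
    then have "letter a \<le> z" by (auto simp: letter_le_iff)
    then obtain y where z: "z = letter a * y" by (auto simp: less_eq_trace_def)
    with letter.prems have "x \<le> y" by (intro letter.IH) auto
    then show ?case unfolding z by (rule times_left_mono)
  qed simp
qed

lemma times_le_cancel [simp]: "x * y \<le> x * z \<longleftrightarrow> y \<le> (z :: 'a::independence_alphabet trace)"
  by (simp add: le_iff_proj_prefix)

lemma times_left_cancel [simp]: "x * y = x * z \<longleftrightarrow> y = (z :: 'a::independence_alphabet trace)"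
  by (metis times_le_cancel order_antisym order_refl)

lemma letters_mono: "x \<le> y \<Longrightarrow> letters x \<subseteq> letters y"
  by (auto simp: less_eq_trace_def)

lemma tlength_mono: "x \<le> y \<Longrightarrow> tlength x \<le> tlength y"
  by (auto simp: less_eq_trace_def tlength_times)

lemma letter_le_times_skip:
  assumes "\<And>e. e \<in> letters x \<Longrightarrow> indep a e"
  shows "letter a \<le> x * z \<longleftrightarrow> letter a \<le> z"
proof -
  have "proj a b x = []" if "\<not> indep a b" for b
  proof -
    have "letters x \<inter> {a, b} = {}" using assms that indep_irrefl[of a] by blast
    then show ?thesis using set_proj[OF that, of x] by simp
  qed
  then show ?thesis by (auto simp: letter_le_iff)
qed

text \<open>
  Prefixes of a common trace \<open>z\<close> correspond to down-closed sets of occurrences of letters in \<open>z\<close>,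
  and the occurrences of a single letter form a chain; so the intersection of two prefixes has the
  minimal number of occurrences of each letter. The induction builds this intersection: the first
  letter \<open>e\<close> of \<open>v\<close> is minimal in \<open>z\<close>, so it either starts \<open>v'\<close> too, or is independent of the
  whole of \<open>v'\<close>, in which case it can be dropped from \<open>v\<close> and \<open>z\<close>.
\<close>

lemma common_prefix_min_occ:
  assumes "v \<le> z" and "v' \<le> z"
  shows "\<exists>w. w \<le> v \<and> w \<le> v' \<and> (\<forall>a. occ a w = min (occ a v) (occ a v'))"
  using assms
proof (induction v arbitrary: v' z rule: trace_induct)
  case one
  show ?case by (rule exI[of _ 1]) simp
next
  case (letter e v)
  from letter.prems obtain y where z: "z = letter e * y" and vy: "v \<le> y"
    by (auto simp: less_eq_trace_def mult.assoc)
  have ez: "prefix [e] (proj e b z)" if "\<not> indep e b" for b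
    using that z by (simp add: proj_letter)
  show ?case
  proof (cases "e \<in> letters v'")
    case True
    have "prefix [e] (proj e b v')" if b: "\<not> indep e b" for b
    proof -
      have "proj e b v' \<noteq> []" using set_proj[OF b, of v'] True by auto
      with ez[OF b] proj_prefix[OF letter.prems(2), of e b] show ?thesis
        by (cases "proj e b v'") (auto simp: prefix_def)
    qed
    then have "letter e \<le> v'" by (simp add: letter_le_iff)
    then obtain u where v': "v' = letter e * u" by (auto simp: less_eq_trace_def)
    with letter.prems z have "u \<le> y" by simp
    from letter.IH[OF vy this] obtain w where
      w: "w \<le> v" "w \<le> u" "\<forall>a. occ a w = min (occ a v) (occ a u)" by blast
    show ?thesis by (rule exI[of _ "letter e * w"]) (use w v' in auto)
  next
    case False
    have ind: "indep e d" if "d \<in> letters v'" for d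
    proof (rule ccontr)
      assume b: "\<not> indep e d"
      with ez[OF b] proj_prefix[OF letter.prems(2), of e d] set_proj[OF b, of v'] that False
      show False by (cases "proj e d v'") (auto simp: prefix_def)
    qed
    have "v' \<le> y" unfolding le_iff_proj_prefix
    proof (intro allI impI)
      fix a b :: 'a assume ab: "\<not> indep a b"
      show "prefix (proj a b v') (proj a b y)"
      proof (cases "e = a \<or> e = b")
        case True
        have "letters v' \<inter> {a, b} = {}"
          using ind ab True False by (auto dest: indep_sym)
        then have "proj a b v' = []" using set_proj[OF ab, of v'] by simp
        then show ?thesis by simp
      next
        case False
        with proj_prefix[OF letter.prems(2), of a b] z show ?thesis by (simp add: proj_letter)
      qed
    qed
    from letter.IH[OF vy this] obtain w where
      w: "w \<le> v" "w \<le> v'" "\<forall>a. occ a w = min (occ a v) (occ a v')" by blast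
    have "letters w \<subseteq> letters v'" using w(2) by (rule letters_mono)
    then have comm: "w * letter e = letter e * w" using ind
    proof (induction w rule: trace_induct)
      case (letter a w)
      then have "letter a * letter e = letter e * letter a" by (intro letter_commute) (auto dest: indep_sym)
      with letter show ?case by (simp add: mult.assoc) (metis mult.assoc)
    qed simp
    from w(1) obtain r where "v = w * r" by (auto simp: less_eq_trace_def)
    then have "letter e * v = w * (letter e * r)" using comm by (metis mult.assoc)
    then have "w \<le> letter e * v" by simp
    moreover have "occ e v' = 0" using False by (simp add: occ_eq_0_iff)
    ultimately show ?thesis using w by (intro exI[of _ w]) auto
  qed
qed

section \<open>Cliques and normal forms\<close>

lemma clique_le_iff:
  assumes "c \<in> cliques"
  shows "c \<le> z \<longleftrightarrow> (\<forall>a\<in>letters c. letter a \<le> z)"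
proof -
  obtain w where w: "sorted_wrt indep w" and c: "c = prod_list (map letter w)"
    using assms by (auto simp: cliques_def)
  from w show ?thesis unfolding c
  proof (induction w arbitrary: z)
    case (Cons a w)
    let ?c = "prod_list (map letter w)"
    have sub: "letters ?c = set w" by (induction w) auto
    have skip: "letter b \<le> letter a * y \<longleftrightarrow> letter b \<le> y" if "b \<in> letters ?c" for b y
      using Cons.prems that sub by (intro letter_le_times_skip) (auto dest: indep_sym)
    show ?case
    proof (cases "letter a \<le> z")
      case True
      then obtain y where "z = letter a * y" by (auto simp: less_eq_trace_def)
      with Cons.IH[of y] Cons.prems skip show ?thesis by auto
    next
      case False
      then have "\<not> letter a * ?c \<le> z" by (meson le_times order_trans)
      with False show ?thesis by simp
    qed
  qed simp
qed

lemma clique_letter_le: "c \<in> cliques \<Longrightarrow> letter a \<le> c \<longleftrightarrow> a \<in> letters c"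
  using clique_le_iff[of c c] letters_mono[of "letter a" c] by auto

lemma clique_le_clique_iff:
  "c \<in> cliques \<Longrightarrow> d \<in> cliques \<Longrightarrow> c \<le> d \<longleftrightarrow> letters c \<subseteq> letters d"
  by (auto simp: clique_le_iff clique_letter_le)

lemma clique_eq_iff: "c \<in> cliques \<Longrightarrow> d \<in> cliques \<Longrightarrow> c = d \<longleftrightarrow> letters c = letters d"
  by (auto simp: clique_le_clique_iff intro: order_antisym)

lemma letters_prod_list: "letters (prod_list (map letter w)) = set w"
  by (induction w) auto

lemma sorted_wrt_indep_distinct: "sorted_wrt indep w \<Longrightarrow> distinct w"
  by (induction w) (auto simp: indep_irrefl)

lemma sorted_wrt_indep_pairwise: "sorted_wrt indep w \<Longrightarrow> pairwise indep (set w)"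
  by (induction w) (auto simp: pairwise_insert dest: indep_sym)

lemma clique_pairwise_indep: "c \<in> cliques \<Longrightarrow> pairwise indep (letters c)"
  by (auto simp: cliques_def letters_prod_list sorted_wrt_indep_pairwise)

lemma tlength_clique: 
  assumes "c \<in> cliques" shows "tlength c = card (letters c)"
proof -
  obtain w where w: "sorted_wrt indep w" and c: "c = prod_list (map letter w)"
    using assms by (auto simp: cliques_def)
  have "tlength c = length w" unfolding c by (induction w) (auto simp: tlength_times)
  then show ?thesis
    using c sorted_wrt_indep_distinct[OF w] by (simp add: letters_prod_list distinct_card)
qed

text \<open>
  Together with \<open>clique_eq_iff\<close> and \<open>clique_le_clique_iff\<close>, this identifies cliques, ordered by
  prefix, with sets of pairwise independent letters, ordered by inclusion.
\<close>

lemma ex_clique: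
  assumes "pairwise indep (S :: 'a::independence_alphabet set)"
  obtains c where "c \<in> cliques" and "letters c = S"
proof -
  obtain w where w: "set w = S" "distinct w" using finite_distinct_list[of S] by auto
  then have "sorted_wrt indep w" using assms
    by (fastforce simp: sorted_wrt_iff_nth_less pairwise_def distinct_conv_nth)
  then show thesis using w that[of "prod_list (map letter w)"]
    by (auto simp: cliques_def letters_prod_list)
qed

lemma minimal_letters_indep: "pairwise indep {a. letter a \<le> z}"
proof (rule pairwiseI, rule ccontr)
  fix a b assume ab: "a \<in> {a. letter a \<le> z}" "b \<in> {a. letter a \<le> z}" "a \<noteq> b" "\<not> indep a b"
  then have "prefix [a] (proj a b z)" "prefix [b] (proj a b z)"
    using proj_prefix[of "letter a" z a b] proj_prefix[of "letter b" z a b]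
    by (auto simp: proj_letter)
  with ab(3) show False by (auto simp: prefix_def)
qed

text \<open>
  A letter minimal in \<open>z\<close> that is missing from the first clique \<open>c\<close> would be independent of \<open>c\<close>,
  hence minimal in the remaining product, and, inductively, a member of the second clique. There the
  relation \<open>c \<rightarrow> d\<close> provides a letter of \<open>c\<close> on which it depends.
\<close>

lemma normal_form_first_clique:
  assumes "is_normal_form z (c # cs)"
  shows "letters c = {a. letter a \<le> z}"
proof -
  have "a \<in> letters c" 
    if "is_normal_form (prod_list (c # cs)) (c # cs)" "letter a \<le> prod_list (c # cs)" for a
    using that
  proof (induction cs arbitrary: c)
    case Nil
    then show ?case using letters_mono[of "letter a" c] by auto
  next
    case (Cons d cs)
    show ?case
    proof (rule ccontr)
      assume a: "a \<notin> letters c"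
      have ind: "indep a e" if e: "e \<in> letters c" for e
      proof (rule ccontr)
        assume ae: "\<not> indep a e"
        have "set (proj a e c) = {e}" using a e set_proj[OF ae, of c] by auto
        moreover have "prefix [a] (proj a e c @ proj a e (prod_list (d # cs)))"
          using Cons.prems(2) ae by (simp add: letter_le_iff)
        ultimately have "a \<in> {e}" by (cases "proj a e c") auto
        with a e show False by auto
      qed
      then have "letter a \<le> prod_list (d # cs)"
        using Cons.prems(2) by (simp add: letter_le_times_skip)
      then have "a \<in> letters d"
        using Cons.prems(1) by (intro Cons.IH) (auto simp: is_normal_form_def)
      moreover have "clique_arrow c d" using Cons.prems(1) by (simp add: is_normal_form_def)
      ultimately obtain e where "e \<in> letters c" "\<not> indep e a" by (auto simp: clique_arrow_def)
      with ind show False by (auto dest: indep_sym)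
    qed
  qed
  moreover have "z = prod_list (c # cs)" "c \<in> cliques" using assms by (auto simp: is_normal_form_def)
  ultimately show ?thesis using assms clique_le_iff[of c z] by auto
qed

lemma normal_form_unique: "is_normal_form z cs \<Longrightarrow> is_normal_form z ds \<Longrightarrow> cs = ds"
proof (induction cs arbitrary: z ds)
  case Nil
  have "prod_list ds \<noteq> 1" if "ds \<noteq> []" "1 \<notin> set ds"
    using that by (cases ds) (auto simp flip: tlength_eq_0_iff simp: tlength_times)
  with Nil show ?case by (auto simp: is_normal_form_def)
next
  case (Cons c cs)
  have "tlength z \<noteq> 0" using Cons.prems(1)
    by (auto simp: is_normal_form_def tlength_times tlength_eq_0_iff)
  then obtain d ds' where ds: "ds = d # ds'"
    using Cons.prems(2) by (cases ds) (auto simp: is_normal_form_def)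
  have "letters c = letters d"
    using normal_form_first_clique Cons.prems unfolding ds by metis
  then have cd: "c = d" using Cons.prems clique_eq_iff[of c d] unfolding ds
    by (auto simp: is_normal_form_def)
  have "is_normal_form (prod_list cs) cs" "is_normal_form (prod_list ds') ds'"
    "c * prod_list cs = d * prod_list ds'"
    using Cons.prems unfolding ds by (auto simp: is_normal_form_def successively_Cons)
  with Cons.IH[of "prod_list cs" ds'] cd ds show ?case by simp
qed

text \<open>
  The first clique consists of all minimal letters of \<open>z\<close>. It is related by \<open>\<rightarrow>\<close> to the next one,
  since a letter independent of the first clique would already be minimal in \<open>z\<close>.
\<close>

lemma normal_form_exists: "\<exists>cs. is_normal_form z cs"
proof (induction "tlength z" arbitrary: z rule: less_induct)
  case less
  show ?case
  proof (cases "z = 1")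
    case True
    then show ?thesis by (intro exI[of _ "[]"]) (simp add: is_normal_form_def)
  next
    case False
    obtain c where c: "c \<in> cliques" "letters c = {a. letter a \<le> z}"
      using ex_clique[OF minimal_letters_indep] .
    then have "c \<le> z" by (simp add: clique_le_iff)
    then obtain y where z: "z = c * y" by (auto simp: less_eq_trace_def)
    have c1: "c \<noteq> 1"
    proof
      assume "c = 1"
      moreover obtain w where "z = prod_list (map letter w)" by (rule trace_cases_word)
      ultimately show False using False c(2) by (cases w) (auto, metis le_times)
    qed
    then have "tlength y < tlength z" using tlength_eq_0_iff[of c] by (simp add: z tlength_times)
    from less[OF this] obtain cs where cs: "is_normal_form y cs" by blast
    have "clique_arrow c d" if d: "cs = d # ds" for d ds
      unfolding clique_arrow_def
    proof (rule ballI, rule ccontr)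
      fix b assume b: "b \<in> letters d" and nd: "\<not> (\<exists>a\<in>letters c. \<not> indep a b)"
      have "letter b \<le> y" using normal_form_first_clique[of y d ds] cs b d by auto
      then have "letter b \<le> z" unfolding z
        using nd by (subst letter_le_times_skip) (auto dest: indep_sym)
      then have "b \<in> letters c" using c by simp
      with nd show False by (auto simp: indep_irrefl)
    qed
    then have "is_normal_form z (c # cs)" using cs c c1
      by (cases cs) (auto simp: is_normal_form_def z)
    then show ?thesis by blast
  qed
qed

lemma is_normal_form_normal_form: "is_normal_form z (normal_form z)"
  unfolding normal_form_def
  by (rule theI') (use normal_form_exists normal_form_unique in blast)

text \<open>
  The first clique of \<open>z\<close> is determined by the minimal letters of \<open>z\<close>; this holds for \<open>z = 1\<close>
  too, thanks to the padding of normal forms by the unit.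
\<close>

lemma nf_clique_eqI:
  assumes "c \<in> cliques" and "letters c = {a. letter a \<le> z}"
  shows "nf_clique 1 z = c"
proof (cases "normal_form z")
  case Nil
  then have "z = 1" using is_normal_form_normal_form[of z] by (simp add: is_normal_form_def)
  then have "letters c = {}" using assms(2) letters_mono[of _ "1 :: 'a trace"] by fastforce
  with Nil show ?thesis by (simp add: nf_clique_def letters_empty_iff)
next
  case (Cons d ds)
  with is_normal_form_normal_form[of z] have nf: "is_normal_form z (d # ds)" by simp
  then have "d \<in> cliques" by (simp add: is_normal_form_def)
  moreover have "letters d = letters c"
    using normal_form_first_clique[OF nf] assms(2) by simp
  ultimately have "d = c" using assms(1) by (simp add: clique_eq_iff)
  with Cons show ?thesis by (simp add: nf_clique_def)
qed

section \<open>Infinite traces\<close>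

abbreviation head_product :: "(nat \<Rightarrow> 'a::independence_alphabet trace) \<Rightarrow> nat \<Rightarrow> 'a trace" where
  "head_product \<omega> n \<equiv> prod_list (map \<omega> [0..<n])"

lemma head_product_add:
  "head_product \<omega> (n + k) = head_product \<omega> n * prod_list (map \<omega> [n..<n + k])"
proof -
  have "[0..<n + k] = [0..<n] @ [n..<n + k]" using upt_add_eq_append[of 0 n k] by simp
  then show ?thesis by (simp del: upt_Suc)
qed

lemma head_product_mono: "m \<le> n \<Longrightarrow> head_product \<omega> m \<le> head_product \<omega> n"
  using head_product_add[of \<omega> m "n - m"] by (simp add: less_eq_trace_def)

lemma prefix_inf_head_product: "prefix_inf (head_product \<omega> n) \<omega>"
  by (auto simp: prefix_inf_def)

lemma prefix_inf_mono: "x \<le> y \<Longrightarrow> prefix_inf y \<omega> \<Longrightarrow> prefix_inf x \<omega>"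
  by (auto simp: prefix_inf_def intro: order_trans)

lemma up_antimono: "x \<le> y \<Longrightarrow> up y \<subseteq> up x"
  by (auto simp: up_def intro: prefix_inf_mono)

lemma prefix_inf_le_head_product:
  assumes "prefix_inf x \<omega>"
  obtains n where "\<And>k. n \<le> k \<Longrightarrow> x \<le> head_product \<omega> k"
  using assms head_product_mono unfolding prefix_inf_def by (meson order_trans)

lemma prefix_inf_common:
  assumes "prefix_inf x \<omega>" and "prefix_inf y \<omega>"
  obtains n where "x \<le> head_product \<omega> n" and "y \<le> head_product \<omega> n"
  using prefix_inf_le_head_product[OF assms(1)] prefix_inf_le_head_product[OF assms(2)]
  by (metis nle_le)

lemma is_normal_form_head_product:
  "\<omega> \<in> infinite_traces \<Longrightarrow> is_normal_form (head_product \<omega> n) (map \<omega> [0..<n])"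
  by (auto simp: is_normal_form_def infinite_traces_def successively_conv_nth)

lemma letters_first_clique:
  assumes "\<omega> \<in> infinite_traces" and "0 < n"
  shows "letters (\<omega> 0) = {a. letter a \<le> head_product \<omega> n}"
proof (rule normal_form_first_clique)
  have "map \<omega> [0..<n] = \<omega> 0 # map \<omega> [1..<n]" using assms(2) by (simp add: upt_conv_Cons)
  then show "is_normal_form (head_product \<omega> n) (\<omega> 0 # map \<omega> [1..<n])"
    using is_normal_form_head_product[OF assms(1), of n] by simp
qed

lemma infinite_traces_clique: "\<omega> \<in> infinite_traces \<Longrightarrow> \<omega> i \<in> cliques"
  by (auto simp: infinite_traces_def)

lemma clique_prefix_inf_iff:
  assumes "c \<in> cliques" and "\<omega> \<in> infinite_traces"
  shows "prefix_inf c \<omega> \<longleftrightarrow> c \<le> \<omega> 0"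
proof
  assume "prefix_inf c \<omega>"
  then obtain n where "\<And>k. n \<le> k \<Longrightarrow> c \<le> head_product \<omega> k"
    using prefix_inf_le_head_product by blast
  then have "c \<le> head_product \<omega> (Suc n)" by (meson le_SucI order_refl)
  then have "letters c \<subseteq> letters (\<omega> 0)"
    using clique_le_iff[OF assms(1)] letters_first_clique[OF assms(2), of "Suc n"] by auto
  then show "c \<le> \<omega> 0"
    using assms by (simp add: clique_le_clique_iff infinite_traces_clique)
next
  assume "c \<le> \<omega> 0"
  then show "prefix_inf c \<omega>"
    using prefix_inf_mono[OF _ prefix_inf_head_product[of \<omega> 1]] by simp
qed

text \<open>
  Whether \<open>x\<close> is below the product of the first \<open>n\<close> cliques depends on finitely many coordinates.
\<close>

lemma openin_up: "openin boundary_topology (up x)"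
proof (subst openin_subopen, rule ballI)
  fix \<omega> assume "\<omega> \<in> up x"
  then obtain n where \<omega>: "\<omega> \<in> infinite_traces" and n: "x \<le> head_product \<omega> n"
    by (auto simp: up_def prefix_inf_def)
  define B where "B = (\<Pi>\<^sub>E i\<in>UNIV. if i < n then {\<omega> i} else cliques)"
  have "finite {i. (if i < n then {\<omega> i} else cliques) \<noteq> topspace (discrete_topology cliques)}"
    by (rule finite_subset[of _ "{..<n}"]) auto
  then have "openin (product_topology (\<lambda>_. discrete_topology cliques) UNIV) B"
    unfolding B_def using \<omega>
    by (intro product_topology_basis) (auto simp: infinite_traces_clique)
  then have "openin boundary_topology (B \<inter> infinite_traces)"
    unfolding boundary_topology_def openin_subtopology by blast
  moreover have "\<omega> \<in> B \<inter> infinite_traces"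
    using \<omega> by (auto simp: B_def infinite_traces_clique)
  moreover have "B \<inter> infinite_traces \<subseteq> up x"
  proof
    fix \<xi> assume \<xi>: "\<xi> \<in> B \<inter> infinite_traces"
    then have "\<xi> i = \<omega> i" if "i < n" for i using that by (auto simp: B_def PiE_iff split: if_splits)
    then have "map \<xi> [0..<n] = map \<omega> [0..<n]" by simp
    with n have "prefix_inf x \<xi>" by (metis prefix_inf_def)
    with \<xi> show "\<xi> \<in> up x" by (simp add: up_def)
  qed
  ultimately show "\<exists>T. openin boundary_topology T \<and> \<omega> \<in> T \<and> T \<subseteq> up x" by blast
qed

lemma boundary_opens_Pow: "{U. openin boundary_topology U} \<subseteq> Pow infinite_traces"
  using openin_subset[of boundary_topology] by (auto simp: boundary_topology_def)

lemma space_boundary_borel [simp]: "space boundary_borel = infinite_traces"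
  unfolding boundary_borel_def using boundary_opens_Pow by (rule space_measure_of)

lemma up_measurable [measurable]: "up x \<in> sets boundary_borel"
  unfolding boundary_borel_def sets_measure_of[OF boundary_opens_Pow]
  by (rule sigma_sets.Basic) (simp add: openin_up)

definition starting_with :: "'a::independence_alphabet trace \<Rightarrow> (nat \<Rightarrow> 'a trace) set" where
  "starting_with c = {\<omega> \<in> infinite_traces. \<omega> 0 = c}"

lemma up_eq_UN_starting_with:
  "c \<in> cliques \<Longrightarrow> up c = (\<Union>d\<in>{d \<in> cliques. c \<le> d}. starting_with d)"
  by (auto simp: up_def starting_with_def clique_prefix_inf_iff infinite_traces_clique)

text \<open>
  \<open>C\<^sub>1(\<omega>) = c\<close> means that \<open>c\<close>, but no larger clique, is a prefix of \<open>\<omega>\<close>.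
\<close>

lemma starting_with_measurable:
  assumes "c \<in> cliques"
  shows "starting_with c \<in> sets boundary_borel"
proof -
  have "starting_with c = up c - (\<Union>d\<in>{d \<in> cliques. c \<le> d \<and> d \<noteq> c}. up d)"
    using assms
    by (auto simp: up_def starting_with_def clique_prefix_inf_iff infinite_traces_clique
        dest: order_antisym) (metis infinite_traces_clique order_refl)
  also have "\<dots> \<in> sets boundary_borel"
    by (intro sets.Diff sets.finite_UN up_measurable) (auto intro: finite_subset[OF _ finite_cliques])
  finally show ?thesis .
qed

section \<open>The Moebius transform\<close>

text \<open>
  The cliques between \<open>c\<close> and \<open>d\<close> form a Boolean lattice, in which even and odd elements are
  equinumerous unless it is a single point.
\<close>

lemma sum_clique_interval:
  fixes c d :: "'a::independence_alphabet trace"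
  assumes c: "c \<in> cliques" and d: "d \<in> cliques" and "c \<le> d"
  shows "(\<Sum>c' | c' \<in> cliques \<and> c \<le> c' \<and> c' \<le> d. (- 1) ^ (tlength c' - tlength c))
       = (if c = d then 1 else (0 :: real))"
proof (cases "c = d")
  case True
  then have "{c'. c' \<in> cliques \<and> c \<le> c' \<and> c' \<le> d} = {c}" using c by auto
  with True show ?thesis by simp
next
  case False
  let ?A = "{c'. c' \<in> cliques \<and> c \<le> c' \<and> c' \<le> d}"
  let ?S = "{T. T \<subseteq> letters d \<and> letters c \<subseteq> T}"
  have bij: "bij_betw letters ?A ?S"
  proof (rule bij_betwI')
    fix T assume T: "T \<in> ?S"
    then have "pairwise indep T" using clique_pairwise_indep[OF d] by (auto intro: pairwise_subset)
    then obtain e where "e \<in> cliques" "letters e = T" by (rule ex_clique)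
    with T c d show "\<exists>e\<in>?A. T = letters e" by (auto simp: clique_le_clique_iff)
  qed (use c d in \<open>auto simp: clique_eq_iff clique_le_clique_iff\<close>)
  have psub: "letters c \<subset> letters d"
    using assms False by (auto simp: clique_le_clique_iff clique_eq_iff)
  have "(- 1) ^ (tlength e - tlength c) = (- 1) ^ card (letters e) * (- 1 :: real) ^ tlength c"
    if "e \<in> ?A" for e
  proof -
    have "tlength e = (tlength e - tlength c) + tlength c" using that tlength_mono by fastforce
    then have "card (letters e) = (tlength e - tlength c) + tlength c"
      using that by (simp add: tlength_clique)
    then show ?thesis
      by (simp only: power_add mult.assoc) (simp flip: power_mult_distrib)
  qed
  then have "(\<Sum>e\<in>?A. (- 1) ^ (tlength e - tlength c))
      = (\<Sum>e\<in>?A. (- 1) ^ card (letters e)) * (- 1 :: real) ^ tlength c"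
    by (simp add: sum_distrib_right)
  also have "(\<Sum>e\<in>?A. (- 1 :: real) ^ card (letters e)) = (\<Sum>T\<in>?S. (- 1) ^ card T)"
    using bij by (rule sum.reindex_bij_betw)
  also have "\<dots> = 0"
    using card_subsupersets_even_odd[OF _ psub]
    by (intro sum_alternating_cancels) (simp_all add: conj_assoc)
  finally show ?thesis using False by simp
qed

text \<open>
  Moebius inversion of \<open>m(\<up>c') = \<Sum>d \<ge> c'. m(C\<^sub>1 = d)\<close>, where \<open>d\<close> ranges over cliques.
\<close>

lemma moebius_sum_up:
  assumes fin: "finite_measure M" and sets: "sets M = sets boundary_borel" and c: "c \<in> cliques"
  shows "(\<Sum>c' | c' \<in> cliques \<and> c \<le> c'. (- 1) ^ (tlength c' - tlength c) * measure M (up c'))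
       = measure M (starting_with c)"
proof -
  let ?A = "{c'. c' \<in> cliques \<and> c \<le> c'}"
  let ?e = "\<lambda>d. measure M (starting_with d)"
  let ?s = "\<lambda>c'. (- 1 :: real) ^ (tlength c' - tlength c)"
  have finA: "finite ?A" by (rule finite_subset[OF _ finite_cliques]) auto
  have up: "measure M (up c') = (\<Sum>d | d \<in> ?A \<and> c' \<le> d. ?e d)" if c': "c' \<in> ?A" for c'
  proof -
    have "measure M (up c') = (\<Sum>d\<in>{d \<in> cliques. c' \<le> d}. ?e d)"
      using c' sets starting_with_measurable
      by (subst up_eq_UN_starting_with, simp, intro finite_measure.finite_measure_finite_Union[OF fin])
        (auto simp: disjoint_family_on_def starting_with_def finite_cliques)
    also have "{d \<in> cliques. c' \<le> d} = {d. d \<in> ?A \<and> c' \<le> d}" using c' by auto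
    finally show ?thesis .
  qed
  have "(\<Sum>c'\<in>?A. ?s c' * measure M (up c')) = (\<Sum>c'\<in>?A. \<Sum>d | d \<in> ?A \<and> c' \<le> d. ?s c' * ?e d)"
    by (simp add: up sum_distrib_left)
  also have "\<dots> = (\<Sum>d\<in>?A. \<Sum>c' | c' \<in> ?A \<and> c' \<le> d. ?s c' * ?e d)"
    using finA finA by (rule sum.swap_restrict)
  also have "\<dots> = (\<Sum>d\<in>?A. if c = d then ?e d else 0)"
  proof (rule sum.cong[OF refl])
    fix d assume "d \<in> ?A"
    then show "(\<Sum>c' | c' \<in> ?A \<and> c' \<le> d. ?s c' * ?e d) = (if c = d then ?e d else 0)"
      using sum_clique_interval[OF c, of d] by (simp add: conj_assoc flip: sum_distrib_right)
  qed
  also have "\<dots> = ?e c" using finA c by simp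
  finally show ?thesis .
qed

section \<open>Every letter occurs almost surely\<close>

text \<open>
  Stopping at the \<open>k\<close>-th \<open>a\<close>: an infinite trace in which \<open>a\<close> occurs at least \<open>k\<close> times has a
  smallest prefix with \<open>k\<close> occurrences of \<open>a\<close>, and \<open>first_hits a b k\<close> collects the prefixes of
  this kind that do not contain \<open>b\<close>.
\<close>

definition first_hits :: "'a::independence_alphabet \<Rightarrow> 'a \<Rightarrow> nat \<Rightarrow> 'a trace set" where
  "first_hits a b k =
     {v. k \<le> occ a v \<and> b \<notin> letters v \<and> (\<forall>w. w \<le> v \<longrightarrow> k \<le> occ a w \<longrightarrow> w = v)}"

text \<open>
  A shortest trace with at least \<open>k\<close> occurrences has no more than \<open>k\<close> of them, because removing
  its last letter loses at most one.
\<close>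

lemma first_hits_occ:
  assumes "v \<in> first_hits a b k"
  shows "occ a v = k"
proof -
  obtain w where v: "v = prod_list (map letter w)" by (rule trace_cases_word)
  show ?thesis
  proof (cases w rule: rev_cases)
    case Nil
    with v assms show ?thesis by (simp add: first_hits_def)
  next
    case (snoc u e)
    define y where "y = prod_list (map letter u)"
    have vy: "v = y * letter e" by (simp add: v snoc y_def)
    have "y \<noteq> v" using tlength_times[of y "letter e"] vy by auto
    then have "\<not> k \<le> occ a y" using assms vy by (auto simp: first_hits_def)
    moreover have "k \<le> occ a v" using assms by (simp add: first_hits_def)
    ultimately show ?thesis by (simp add: vy split: if_splits)
  qed
qed

lemma ex_first_hit:
  assumes "k \<le> occ a v" and "b \<notin> letters v"
  obtains w where "w \<in> first_hits a b k" and "w \<le> v"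
proof -
  let ?P = "\<lambda>w. w \<le> v \<and> k \<le> occ a w"
  have "?P v" using assms by simp
  then obtain w where w: "?P w" and min: "\<And>u. ?P u \<Longrightarrow> tlength w \<le> tlength u"
    using ex_has_least_nat[of ?P v tlength] by blast
  have "u = w" if u: "u \<le> w" "k \<le> occ a u" for u
  proof -
    have "tlength w \<le> tlength u" using min u w by (meson order_trans)
    moreover obtain r where r: "w = u * r" using u by (auto simp: less_eq_trace_def)
    ultimately have "r = 1" by (simp add: tlength_times flip: tlength_eq_0_iff)
    with r show ?thesis by simp
  qed
  moreover have "b \<notin> letters w" using w assms letters_mono by blast
  ultimately have "w \<in> first_hits a b k" using w by (auto simp: first_hits_def)
  with w show thesis using that by blast
qed

lemma first_hits_unique:
  assumes "v \<in> first_hits a b k" "v' \<in> first_hits a b k" and "v \<le> z" "v' \<le> z"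
  shows "v = v'"
proof -
  obtain w where "w \<le> v" "w \<le> v'" "occ a w = min (occ a v) (occ a v')"
    using common_prefix_min_occ[OF assms(3,4)] by blast
  with assms show ?thesis by (auto simp: first_hits_def)
qed

text \<open>
  The projections to \<open>{a, b}\<close> of two prefixes of \<open>z\<close> are comparable words. After \<open>x v\<close>, one
  of them would continue with \<open>K\<close> letters \<open>a\<close> and no \<open>b\<close>, the other one with fewer than \<open>K\<close>
  letters \<open>a\<close> followed by \<open>b\<close>.
\<close>

lemma first_hits_excludes:
  assumes ab: "\<not> indep a b" "a \<noteq> b"
    and v: "v \<in> first_hits a b k" and v': "v' \<in> first_hits a b (k + K)"
    and u: "occ a u < K" and "x * v' \<le> z"
  shows "\<not> x * (v * (u * letter b)) \<le> z"
proof
  assume "x * (v * (u * letter b)) \<le> z"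
  then have "prefix (proj a b x @ (proj a b v @ proj a b u @ [b])) (proj a b z)"
    using proj_prefix[of "x * (v * (u * letter b))" z a b] ab by (simp add: proj_letter)
  moreover have "prefix (proj a b x @ proj a b v') (proj a b z)"
    using proj_prefix[OF assms(6), of a b] by simp
  ultimately consider "prefix (proj a b v @ proj a b u @ [b]) (proj a b v')"
    | "prefix (proj a b v') (proj a b v @ proj a b u @ [b])"
    using prefix_same_cases by fastforce
  then show False
  proof cases
    case 1
    then have "b \<in> set (proj a b v')" by (auto simp: prefix_def)
    then show False using v' ab by (simp add: set_proj first_hits_def)
  next
    case 2
    then have "count_list (proj a b v') a \<le> count_list (proj a b v @ proj a b u @ [b]) a"
      by (metis prefix_def count_list_append le_add1)
    then show False using u ab first_hits_occ[OF v] first_hits_occ[OF v']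
      by (simp add: count_proj)
  qed
qed

text \<open>
  If \<open>a\<close> and \<open>b\<close> are dependent, this is the event that \<open>x\<close> is a prefix and that, after \<open>x\<close>, the
  letter \<open>a\<close> occurs at least \<open>k\<close> times before the first \<open>b\<close>.
\<close>

definition avoiding :: "'a::independence_alphabet \<Rightarrow> 'a \<Rightarrow> 'a trace \<Rightarrow> nat \<Rightarrow> (nat \<Rightarrow> 'a trace) set" where
  "avoiding a b x k = (\<Union>v\<in>first_hits a b k. up (x * v))"

lemma avoiding_measurable: "avoiding a b x k \<in> sets boundary_borel"
  unfolding avoiding_def
  by (intro sets.countable_UN'' up_measurable countable_subset[OF subset_UNIV countable_traces])

lemma avoiding_antimono:
  assumes "j \<le> k" shows "avoiding a b x k \<subseteq> avoiding a b x j"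
proof
  fix \<omega> assume "\<omega> \<in> avoiding a b x k"
  then obtain v where v: "v \<in> first_hits a b k" "\<omega> \<in> up (x * v)" by (auto simp: avoiding_def)
  with assms obtain w where "w \<in> first_hits a b j" "w \<le> v"
    using ex_first_hit[of j a v b] by (auto simp: first_hits_def)
  then show "\<omega> \<in> avoiding a b x j"
    using v up_antimono[of "x * w" "x * v"] by (auto simp: avoiding_def)
qed

lemma disjoint_first_hits: "disjoint_family_on (\<lambda>v. up (x * v)) (first_hits a b k)"
proof -
  have "v = v'" if v: "v \<in> first_hits a b k" "v' \<in> first_hits a b k"
    and "\<omega> \<in> up (x * v)" "\<omega> \<in> up (x * v')" for v v' \<omega>
  proof -
    from that obtain n where n: "x * v \<le> head_product \<omega> n" "x * v' \<le> head_product \<omega> n"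
      by (auto simp: up_def elim: prefix_inf_common)
    then obtain z where "head_product \<omega> n = x * z" by (auto simp: less_eq_trace_def mult.assoc)
    with n show ?thesis using first_hits_unique[OF v] by simp
  qed
  then show ?thesis by (auto simp: disjoint_family_on_def)
qed

lemma markov_measureD:
  assumes "markov_measure act m"
  shows "prob_space (m \<alpha>)" and "sets (m \<alpha>) = sets boundary_borel"
    and "measure (m \<alpha>) (infinite_traces_from act \<alpha>) = 1"
    and "x \<in> traces_from act \<alpha> \<longleftrightarrow> measure (m \<alpha>) (up x) > 0"
    and "act (Some \<alpha>) x = Some \<beta> \<Longrightarrow>
      measure (m \<alpha>) (up (x * y)) = measure (m \<alpha>) (up x) * measure (m \<beta>) (up y)"
  using assms by (simp_all add: markov_measure_def)

lemma markov_measure_AE_from: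
  assumes "markov_measure act m"
  shows "AE \<omega> in m \<alpha>. \<omega> \<in> infinite_traces_from act \<alpha>"
proof -
  interpret prob_space "m \<alpha>" using assms by (rule markov_measureD)
  show ?thesis using markov_measureD(3)[OF assms] by (rule AE_prob_1)
qed

text \<open>
  After a prefix \<open>y\<close> leading to the state \<open>\<beta>\<close>, the trace \<open>u b\<close> follows with the conditional
  probability \<open>m\<^bsub>\<beta>\<^esub>(\<up>(u b))\<close>. Finiteness of the set of states makes the lower bound \<open>p\<close> and the
  bound \<open>K\<close> on the number of \<open>a\<close> in \<open>u\<close> uniform.
\<close>

lemma ex_uniform_continuation:
  fixes act :: "('s::finite, 'a::independence_alphabet) action"
  assumes irr: "irreducible_system act" and mm: "markov_measure act m"
  obtains p :: real and K where "0 < p" and "p \<le> 1" and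
    "\<And>\<alpha> y. \<exists>u. occ a u < K \<and>
       measure (m \<alpha>) (up y - up (y * (u * letter b))) \<le> (1 - p) * measure (m \<alpha>) (up y)"
proof -
  have "\<forall>\<beta>. \<exists>u. act (Some \<beta>) (u * letter b) \<noteq> None"
    using irr by (auto simp: irreducible_system_def)
  then obtain u where u: "\<And>\<beta>. act (Some \<beta>) (u \<beta> * letter b) \<noteq> None" by metis
  define q where "q \<beta> = measure (m \<beta>) (up (u \<beta> * letter b))" for \<beta>
  define p where "p = Min (range q)"
  define K where "K = Suc (Max (range (\<lambda>\<beta>. occ a (u \<beta>))))"
  have q: "0 < q \<beta>" "q \<beta> \<le> 1" for \<beta>
  proof -
    show "0 < q \<beta>"
      unfolding q_def using u[of \<beta>] markov_measureD(4)[OF mm, of "u \<beta> * letter b" \<beta>]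
      by (simp add: traces_from_def)
    show "q \<beta> \<le> 1"
      unfolding q_def using mm by (intro prob_space.prob_le_1) (rule markov_measureD)
  qed
  have pq: "p \<le> q \<beta>" for \<beta> by (simp add: p_def)
  have "p \<in> range q" unfolding p_def by (rule Min_in) auto
  then have p: "0 < p" "p \<le> 1" using q by auto
  have K: "occ a (u \<beta>) < K" for \<beta> by (simp add: K_def less_Suc_eq_le)
  have "\<exists>w. occ a w < K \<and>
       measure (m \<alpha>) (up y - up (y * (w * letter b))) \<le> (1 - p) * measure (m \<alpha>) (up y)" for \<alpha> y
  proof (cases "act (Some \<alpha>) y")
    case None
    \<comment> \<open>Both sides vanish; any of the chosen traces will do.\<close>
    then have "\<not> 0 < measure (m \<alpha>) (up y)"
      by (simp add: traces_from_def flip: markov_measureD(4)[OF mm])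
    then have 0: "measure (m \<alpha>) (up y) = 0" by (simp add: zero_less_measure_iff)
    interpret prob_space "m \<alpha>" using mm by (rule markov_measureD)
    have "measure (m \<alpha>) (up y - up (y * (u undefined * letter b))) \<le> measure (m \<alpha>) (up y)"
      using markov_measureD(2)[OF mm] by (intro finite_measure_mono) (auto simp: up_measurable)
    with 0 K[of undefined] show ?thesis by auto
  next
    case (Some \<beta>)
    interpret prob_space "m \<alpha>" using mm by (rule markov_measureD)
    have "measure (m \<alpha>) (up y - up (y * (u \<beta> * letter b)))
        = measure (m \<alpha>) (up y) - measure (m \<alpha>) (up (y * (u \<beta> * letter b)))"
      using markov_measureD(2)[OF mm] by (intro finite_measure_Diff) (simp_all add: up_measurable up_antimono)
    also have "\<dots> = (1 - q \<beta>) * measure (m \<alpha>) (up y)"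
      using markov_measureD(5)[OF mm Some] by (simp add: q_def algebra_simps)
    also have "\<dots> \<le> (1 - p) * measure (m \<alpha>) (up y)"
      using pq by (intro mult_right_mono) auto
    finally show ?thesis using K by blast
  qed
  with p show thesis by (rule that)
qed

text \<open>
  The disjoint sets \<open>\<up>(x v)\<close>, for \<open>v\<close> a first hit of level \<open>k\<close>, cover the event of level \<open>k + K\<close>,
  and within each of them that event excludes the continuation \<open>u b\<close>.
\<close>

lemma avoiding_contraction:
  assumes ab: "\<not> indep a b" "a \<noteq> b" and "prob_space M" and M: "sets M = sets boundary_borel"
    and p: "p \<le> 1"
    and cont: "\<And>y. \<exists>u. occ a u < K \<and>
       measure M (up y - up (y * (u * letter b))) \<le> (1 - p) * measure M (up y)"
  shows "measure M (avoiding a b x (k + K)) \<le> (1 - p) * measure M (avoiding a b x k)"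
proof -
  interpret prob_space M by fact
  let ?V = "first_hits a b k" and ?D = "avoiding a b x (k + K)"
  have cV: "countable ?V" by (rule countable_subset[OF subset_UNIV countable_traces])
  have D: "?D \<in> sets M" using M avoiding_measurable by blast
  have piece: "emeasure M (?D \<inter> up (x * v)) \<le> ennreal (1 - p) * emeasure M (up (x * v))"
    if v: "v \<in> ?V" for v
  proof -
    obtain u where u: "occ a u < K" and
      le: "measure M (up (x * v) - up (x * v * (u * letter b))) \<le> (1 - p) * measure M (up (x * v))"
      using cont by blast
    \<comment> \<open>The next \<open>K\<close> occurrences of \<open>a\<close> come before \<open>b\<close>, so the continuation \<open>u b\<close> is missed.\<close>
    have "?D \<inter> up (x * v) \<subseteq> up (x * v) - up (x * v * (u * letter b))"
    proof -
      have "\<not> prefix_inf (x * v * (u * letter b)) \<omega>"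
        if v': "v' \<in> first_hits a b (k + K)" "prefix_inf (x * v') \<omega>" for \<omega> v'
      proof
        assume "prefix_inf (x * v * (u * letter b)) \<omega>"
        with v'(2) obtain n where
          "x * v' \<le> head_product \<omega> n" "x * (v * (u * letter b)) \<le> head_product \<omega> n"
          by (metis prefix_inf_common mult.assoc)
        with first_hits_excludes[OF ab v v'(1) u] show False by blast
      qed
      then show ?thesis by (auto simp: avoiding_def up_def)
    qed
    then have "measure M (?D \<inter> up (x * v)) \<le> measure M (up (x * v) - up (x * v * (u * letter b)))"
      using M up_measurable by (intro finite_measure_mono) auto
    with le have "measure M (?D \<inter> up (x * v)) \<le> (1 - p) * measure M (up (x * v))" by simp
    then show ?thesis using p by (simp add: emeasure_eq_measure flip: ennreal_mult)
  qed
  have "?D = (\<Union>v\<in>?V. ?D \<inter> up (x * v))"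
    using avoiding_antimono[of k "k + K" a b x] by (auto simp: avoiding_def)
  then have "emeasure M ?D = emeasure M (\<Union>v\<in>?V. ?D \<inter> up (x * v))" by simp
  also have "\<dots> = (\<integral>\<^sup>+v. emeasure M (?D \<inter> up (x * v)) \<partial>count_space ?V)"
    using D M up_measurable cV disjoint_first_hits[of x a b k]
    by (intro emeasure_UN_countable) (auto simp: disjoint_family_on_def)
  also have "\<dots> \<le> (\<integral>\<^sup>+v. ennreal (1 - p) * emeasure M (up (x * v)) \<partial>count_space ?V)"
    by (intro nn_integral_mono) (simp add: piece)
  also have "\<dots> = ennreal (1 - p) * (\<integral>\<^sup>+v. emeasure M (up (x * v)) \<partial>count_space ?V)"
    by (rule nn_integral_cmult) simp
  also have "(\<integral>\<^sup>+v. emeasure M (up (x * v)) \<partial>count_space ?V) = emeasure M (avoiding a b x k)"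
    unfolding avoiding_def using M up_measurable cV disjoint_first_hits
    by (intro emeasure_UN_countable [symmetric]) auto
  finally show ?thesis using p by (simp add: emeasure_eq_measure flip: ennreal_mult)
qed

lemma avoiding_null:
  fixes act :: "('s::finite, 'a::independence_alphabet) action"
  assumes irr: "irreducible_system act" and mm: "markov_measure act m"
    and ab: "\<not> indep a b" "a \<noteq> b"
  shows "(\<Inter>k. avoiding a b x k) \<in> null_sets (m \<alpha>)"
proof -
  interpret prob_space "m \<alpha>" using mm by (rule markov_measureD)
  have M: "sets (m \<alpha>) = sets boundary_borel" using mm by (rule markov_measureD)
  obtain p :: real and K where p: "0 < p" "p \<le> 1" and
    cont: "\<And>\<alpha> y. \<exists>u. occ a u < K \<and>
       measure (m \<alpha>) (up y - up (y * (u * letter b))) \<le> (1 - p) * measure (m \<alpha>) (up y)"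
    using ex_uniform_continuation[OF irr mm, of a b] by blast
  let ?A = "\<Inter>k. avoiding a b x k"
  have A: "?A \<in> sets (m \<alpha>)" using M avoiding_measurable by (intro sets.countable_INT) auto
  have geo: "prob (avoiding a b x (j * K)) \<le> (1 - p) ^ j" for j
  proof (induction j)
    case (Suc j)
    have "prob (avoiding a b x (j * K + K)) \<le> (1 - p) * prob (avoiding a b x (j * K))"
      using ab prob_space_axioms M p(2) cont by (rule avoiding_contraction)
    also have "\<dots> \<le> (1 - p) * (1 - p) ^ j" using Suc p by (intro mult_left_mono) auto
    finally show ?case by (simp add: add.commute)
  qed simp
  have "prob ?A \<le> (1 - p) ^ j" for j
  proof -
    have "prob ?A \<le> prob (avoiding a b x (j * K))"
      using M avoiding_measurable by (intro finite_measure_mono) auto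
    with geo[of j] show ?thesis by linarith
  qed
  moreover have "(\<lambda>j. (1 - p) ^ j) \<longlonglongrightarrow> 0" using p by (intro LIMSEQ_power_zero) auto
  ultimately have "prob ?A \<le> 0" by (intro LIMSEQ_le_const) auto
  then have "prob ?A = 0" by (simp add: measure_le_0_iff)
  then show ?thesis using A by (simp add: null_sets_def emeasure_eq_measure)
qed

lemma rtranclp_leaves_set:
  assumes "R\<^sup>*\<^sup>* a b" and "a \<in> S" and "b \<notin> S"
  obtains c d where "R c d" and "c \<in> S" and "d \<notin> S"
proof -
  have "\<exists>c d. R c d \<and> c \<in> S \<and> d \<notin> S" using assms
    by (induction rule: rtranclp_induct) blast+
  then show thesis using that by blast
qed

text \<open>
  Along a path in the dependence graph from a letter that occurs infinitely often to one that does
  not, there are neighbours \<open>a\<close> and \<open>b\<close> of these two kinds; \<open>x\<close> is a prefix of \<open>\<omega>\<close> that contains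
  all occurrences of \<open>b\<close>.
\<close>

lemma missing_letter_avoiding:
  assumes irr: "irreducible_trace_monoid TYPE('a::independence_alphabet)"
    and \<omega>: "\<omega> \<in> infinite_traces"
    and miss: "\<And>x :: 'a trace. prefix_inf x \<omega> \<Longrightarrow> letters x \<noteq> UNIV"
  obtains a b x where "\<not> indep a b" and "a \<noteq> b" and "\<omega> \<in> (\<Inter>k. avoiding a b x k)"
proof -
  define S where "S = {a. \<exists>\<^sub>\<infinity>i. a \<in> letters (\<omega> i)}"
  have "\<exists>a. \<exists>\<^sub>\<infinity>i. a \<in> letters (\<omega> i)"
  proof -
    have "letters (\<omega> i) \<noteq> {}" for i using \<omega> by (auto simp: infinite_traces_def letters_empty_iff)
    then have "{i. \<exists>a\<in>UNIV. a \<in> letters (\<omega> i)} = UNIV" by auto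
    then have "\<exists>\<^sub>\<infinity>i. \<exists>a\<in>UNIV. a \<in> letters (\<omega> i)" by (simp add: INFM_iff_infinite)
    then have "\<exists>a\<in>UNIV. \<exists>\<^sub>\<infinity>i. a \<in> letters (\<omega> i)"
      by (subst (asm) INFM_finite_Bex_distrib) simp_all
    then show ?thesis by simp
  qed
  then obtain a0 where a0: "a0 \<in> S" by (auto simp: S_def)
  have lp: "letters (prod_list (map \<omega> js)) = (\<Union>i\<in>set js. letters (\<omega> i))" for js
    by (induction js) auto
  have "\<exists>b0. b0 \<notin> S"
  proof (rule ccontr)
    assume "\<not> (\<exists>b0. b0 \<notin> S)"
    then have "\<forall>a. \<exists>i. a \<in> letters (\<omega> i)" by (auto simp: S_def dest: INFM_EX)
    then obtain i where i: "\<And>a. a \<in> letters (\<omega> (i a))" by metis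
    have "a \<in> letters (head_product \<omega> (Suc (Max (range i))))" for a
      unfolding lp set_upt using i by (intro UN_I[of "i a"]) (simp_all add: less_Suc_eq_le)
    then have "letters (head_product \<omega> (Suc (Max (range i)))) = UNIV" by blast
    with miss[OF prefix_inf_head_product] show False by blast
  qed
  then obtain b0 where b0: "b0 \<notin> S" by blast
  from irr have "(\<lambda>a b. \<not> indep a b)\<^sup>*\<^sup>* a0 b0" by (simp add: irreducible_trace_monoid_def)
  from this a0 b0 obtain a b where ab: "\<not> indep a b" "a \<in> S" "b \<notin> S"
    by (rule rtranclp_leaves_set)
  from ab(3) obtain n where n: "\<And>i. n \<le> i \<Longrightarrow> b \<notin> letters (\<omega> i)"
    by (auto simp: S_def INFM_nat_le)
  have many: "\<exists>N. k \<le> occ a (prod_list (map \<omega> [n..<n + N]))" for k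
  proof (induction k)
    case (Suc k)
    then obtain N where N: "k \<le> occ a (prod_list (map \<omega> [n..<n + N]))" by blast
    obtain i where i: "n + N \<le> i" "a \<in> letters (\<omega> i)"
      using ab(2) by (auto simp: S_def INFM_nat_le)
    define d where "d = i - (n + N)"
    have "[n..<n + (N + d + 1)] = [n..<n + N] @ [n + N..<i] @ [i]"
      using i upt_add_eq_append[of n "n + N" d] by (simp add: d_def)
    moreover have "0 < occ a (\<omega> i)" using i(2) occ_eq_0_iff[of a "\<omega> i"] by auto
    ultimately have "Suc k \<le> occ a (prod_list (map \<omega> [n..<n + (N + d + 1)]))"
      using N by (simp del: upt_Suc)
    then show ?case by blast
  qed simp
  have "\<omega> \<in> avoiding a b (head_product \<omega> n) k" for k
  proof -
    obtain N where "k \<le> occ a (prod_list (map \<omega> [n..<n + N]))" using many by blast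
    moreover have "b \<notin> letters (prod_list (map \<omega> [n..<n + N]))" using n by (auto simp: lp)
    ultimately obtain w where w: "w \<in> first_hits a b k" "w \<le> prod_list (map \<omega> [n..<n + N])"
      by (rule ex_first_hit)
    then have "head_product \<omega> n * w \<le> head_product \<omega> (n + N)"
      by (simp add: head_product_add del: upt_Suc)
    then have "prefix_inf (head_product \<omega> n * w) \<omega>"
      using prefix_inf_head_product by (rule prefix_inf_mono)
    with w \<omega> show ?thesis by (auto simp: avoiding_def up_def)
  qed
  with ab show thesis by (intro that[of a b "head_product \<omega> n"]) auto
qed

theorem AE_all_letters_occur:
  fixes act :: "('s::finite, 'a::independence_alphabet) action"
  assumes irr: "irreducible_system act" and mm: "markov_measure act m"
  shows "AE \<omega> in m \<alpha>. \<exists>x. prefix_inf x \<omega> \<and> letters x = UNIV"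
proof -
  let ?I = "{(a, b, x :: 'a trace). \<not> indep a b \<and> a \<noteq> b}"
  let ?N = "\<Union>(a, b, x)\<in>?I. \<Inter>k. avoiding a b x k"
  have "countable ?I"
    by (rule countable_subset[of _ "UNIV \<times> UNIV \<times> UNIV"], simp,
        intro countable_SIGMA countable_traces countable_finite[OF finite])
  then have "?N \<in> null_sets (m \<alpha>)"
    using avoiding_null[OF irr mm] by (intro null_sets_UN') auto
  moreover have "{\<omega> \<in> space (m \<alpha>). \<not> (\<exists>x. prefix_inf x \<omega> \<and> letters x = UNIV)} \<subseteq> ?N"
  proof safe
    fix \<omega> assume "\<omega> \<in> space (m \<alpha>)" and no: "\<not> (\<exists>x. prefix_inf x \<omega> \<and> letters x = UNIV)"
    then have \<omega>: "\<omega> \<in> infinite_traces"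
      using sets_eq_imp_space_eq[OF markov_measureD(2)[OF mm, of \<alpha>]] by simp
    have "irreducible_trace_monoid TYPE('a)" using irr by (simp add: irreducible_system_def)
    from missing_letter_avoiding[OF this \<omega>] no obtain a b x
      where "\<not> indep a b" "a \<noteq> b" "\<omega> \<in> (\<Inter>k. avoiding a b x k)" by metis
    then show "\<omega> \<in> ?N" by blast
  qed
  ultimately show ?thesis by (rule AE_I')
qed

section \<open>Stability\<close>

text \<open>
  A minimal letter of an extension of \<open>x\<close> begins all its projections to dependent pairs. These
  projections start with those of \<open>x\<close>, which are not empty because all letters occur in \<open>x\<close>.
\<close>

lemma le_keeps_minimal_letters:
  assumes "letters x = UNIV" and "x \<le> z"
  shows "{a. letter a \<le> z} = {a. letter a \<le> x}"
proof -
  have "letter a \<le> x" if a: "letter a \<le> z" for a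
    unfolding letter_le_iff
  proof (intro allI impI)
    fix b assume b: "\<not> indep a b"
    have "proj a b x \<noteq> []" using set_proj[OF b, of x] assms(1) by auto
    moreover have "prefix [a] (proj a b z)" using a b by (simp add: letter_le_iff)
    moreover have "prefix (proj a b x) (proj a b z)" using assms(2) by (rule proj_prefix)
    ultimately show "prefix [a] (proj a b x)" by (cases "proj a b x") (auto simp: prefix_def)
  qed
  then show ?thesis using assms(2) by (auto intro: order_trans)
qed

text \<open>
  The right-hand side is \<open>h\<^bsub>\<alpha>\<^esub>(c) > 0\<close> in probabilistic terms. From left to right, compare
  \<open>{C\<^sub>1 = c}\<close> with \<open>\<up>x\<close> for a witness \<open>x\<close> of stability; from right to left, choose as witness a
  long prefix of an infinite trace in \<open>{C\<^sub>1 = c}\<close> in which all letters occur.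
\<close>

lemma stable_iff_starting_with_pos:
  fixes act :: "('s::finite, 'a::independence_alphabet) action"
  assumes irr: "irreducible_system act" and mm: "markov_measure act m" and c: "c \<in> cliques"
  shows "stable_state_clique act \<alpha> c \<longleftrightarrow> 0 < measure (m \<alpha>) (starting_with c)"
proof
  interpret prob_space "m \<alpha>" using mm by (rule markov_measureD)
  have M: "sets (m \<alpha>) = sets boundary_borel" using mm by (rule markov_measureD)
  have E: "starting_with c \<in> events" using M starting_with_measurable[OF c] by simp
  {
    assume "stable_state_clique act \<alpha> c"
    then obtain x where x: "x \<in> traces_from act \<alpha>"
      and nf: "\<And>z. z \<in> traces_from act \<alpha> \<Longrightarrow> x \<le> z \<Longrightarrow> nf_clique 1 z = c"
      by (auto simp: stable_state_clique_def)
    have "\<omega> \<in> starting_with c" if \<omega>: "\<omega> \<in> infinite_traces_from act \<alpha>" "\<omega> \<in> up x" for \<omega>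
    proof -
      have inf: "\<omega> \<in> infinite_traces" using \<omega> by (simp add: up_def)
      from \<omega>(2) have "prefix_inf x \<omega>" by (simp add: up_def)
      then obtain n where n: "\<And>k. n \<le> k \<Longrightarrow> x \<le> head_product \<omega> k"
        using prefix_inf_le_head_product by blast
      \<comment> \<open>The product must be non-empty for its first clique to be \<open>C\<^sub>1(\<omega>)\<close>.\<close>
      then have "x \<le> head_product \<omega> (Suc n)" by (meson le_SucI order_refl)
      moreover have "head_product \<omega> (Suc n) \<in> traces_from act \<alpha>"
        using \<omega>(1) prefix_inf_head_product[of \<omega> "Suc n"] unfolding infinite_traces_from_def by blast
      ultimately have "nf_clique 1 (head_product \<omega> (Suc n)) = c" by (intro nf)
      moreover have "nf_clique 1 (head_product \<omega> (Suc n)) = \<omega> 0"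
        using inf by (intro nf_clique_eqI letters_first_clique infinite_traces_clique) auto
      ultimately show ?thesis using inf by (simp add: starting_with_def)
    qed
    then have "AE \<omega> in m \<alpha>. \<omega> \<in> up x \<longrightarrow> \<omega> \<in> starting_with c"
      using markov_measure_AE_from[OF mm, of \<alpha>] by auto
    then have "prob (up x) \<le> prob (starting_with c)" using E by (rule finite_measure_mono_AE)
    moreover have "0 < prob (up x)" using x markov_measureD(4)[OF mm] by blast
    ultimately show "0 < prob (starting_with c)" by simp
  }
  {
    assume pos: "0 < prob (starting_with c)"
    have "\<exists>\<omega>\<in>starting_with c. \<omega> \<in> infinite_traces_from act \<alpha> \<and> (\<exists>x. prefix_inf x \<omega> \<and> letters x = UNIV)"
    proof (rule ccontr)
      assume "\<not> ?thesis"
      then have "AE \<omega> in m \<alpha>. \<omega> \<notin> starting_with c"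
        using markov_measure_AE_from[OF mm, of \<alpha>] AE_all_letters_occur[OF irr mm, of \<alpha>] by auto
      then have "prob (starting_with c) = 0" using E by (simp add: prob_eq_0)
      with pos show False by simp
    qed
    then obtain \<omega> x where \<omega>: "\<omega> \<in> starting_with c" "\<omega> \<in> infinite_traces_from act \<alpha>"
      and x: "prefix_inf x \<omega>" "letters x = UNIV" by blast
    from x(1) obtain n where n: "\<And>k. n \<le> k \<Longrightarrow> x \<le> head_product \<omega> k"
      using prefix_inf_le_head_product by blast
    define y where "y = head_product \<omega> (Suc n)"
    have "x \<le> y" unfolding y_def by (intro n) simp
    then have all: "letters y = UNIV" using x(2) letters_mono by blast
    have inf: "\<omega> \<in> infinite_traces" using \<omega>(1) by (simp add: starting_with_def)
    have first: "letters c = {a. letter a \<le> y}"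
      using letters_first_clique[OF inf, of "Suc n"] \<omega>(1) unfolding y_def
      by (simp add: starting_with_def)
    have "y \<in> traces_from act \<alpha>"
      using \<omega>(2) prefix_inf_head_product[of \<omega> "Suc n"]
      unfolding infinite_traces_from_def y_def by blast
    moreover have "nf_clique 1 z = c" if "y \<le> z" for z
      using le_keeps_minimal_letters[OF all that] first by (intro nf_clique_eqI c) simp
    ultimately show "stable_state_clique act \<alpha> c" by (auto simp: stable_state_clique_def)
  }
qed

theorem corollary4p15:
  fixes act :: "('s::finite, 'a::independence_alphabet) action"
  assumes "irreducible_system act"
  shows "(\<forall>f. probabilistic_valuation act f \<longrightarrow>
            (\<forall>\<alpha> c. state_and_clique act \<alpha> c \<longrightarrow>
               (stable_state_clique act \<alpha> c \<longleftrightarrow> moebius_transform f \<alpha> c > 0)))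
       \<and> (\<forall>f g. probabilistic_valuation act f \<longrightarrow> probabilistic_valuation act g \<longrightarrow>
            (\<forall>\<alpha> c. state_and_clique act \<alpha> c \<longrightarrow>
               (moebius_transform f \<alpha> c > 0 \<longleftrightarrow> moebius_transform g \<alpha> c > 0)))"
proof -
  have "stable_state_clique act \<alpha> c \<longleftrightarrow> moebius_transform f \<alpha> c > 0"
    if "probabilistic_valuation act f" and sc: "state_and_clique act \<alpha> c" for f \<alpha> c
  proof -
    from that(1) obtain m where mm: "markov_measure act m"
      and f: "\<And>\<alpha> x. f \<alpha> x = measure (m \<alpha>) (up x)"
      by (auto simp: probabilistic_valuation_def)
    have c: "c \<in> cliques" using sc by (simp add: state_and_clique_def)
    have "finite_measure (m \<alpha>)" using mm by (intro prob_space.finite_measure markov_measureD)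
    then have "moebius_transform f \<alpha> c = measure (m \<alpha>) (starting_with c)"
      unfolding moebius_transform_def f using markov_measureD(2)[OF mm] c by (rule moebius_sum_up)
    then show ?thesis using stable_iff_starting_with_pos[OF assms mm c] by simp
  qed
  then show ?thesis by blast
qed

end
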